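(* For any $n\ge 5$, $2n+3\le g(n)\le (n+1)2^{\frac{1}{2}n\log_2 n}$.
   Context: A simple game is $(P,W)$ with $P=[n]$, $W\subseteq 2^P$ (winning coalitions) closed under supersets within $P$, $W\ne\emptyset$, $W\ne 2^P$; other coalitions are losing. It is roughly weighted if there exist non-negative reals $w_1,\dots,w_n$ and a real $q$, not all zero, such that $\sum_{i\in X}w_i<q$ implies $X$ losing and $\sum_{i\in X}w_i>q$ implies $X$ winning. A trading transform of length $j$ is $(X_1,\dots,X_j;Y_1,\dots,Y_j)$ with every player in equally many $X_i$'s and $Y_i$'s; it is a certificate of non-weightedness if all $X_i$ are winning and all $Y_i$ losing, and potent if additionally $P$ is among the $X_i$ and $\emptyset$ among the $Y_i$. For a game $G$, $g(G)$ is the length of the shortest potent certificate of non-weightedness ($\infty$ if $G$ is roughly weighted), and $g(n)=\max_G g(G)$ over all non-roughly-weighted simple games $G$ with $n$ players. *)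

theory Defs
  imports Complex_Main "HOL-Library.Extended_Nat" "HOL-Library.Extended_Real"
begin

text \<open>A simple game is a finite set \<open>P\<close> of players together with the set \<open>W\<close> of its winning coalitions.\<close>

definition simple_game :: "'a set \<Rightarrow> 'a set set \<Rightarrow> bool" where
  "simple_game P W \<longleftrightarrow>
     finite P \<and> W \<subseteq> Pow P \<and>
     (\<forall>X Y. X \<in> W \<and> X \<subseteq> Y \<and> Y \<subseteq> P \<longrightarrow> Y \<in> W) \<and>
     W \<noteq> {} \<and> W \<noteq> Pow P"

definition winning :: "'a set \<Rightarrow> 'a set set \<Rightarrow> 'a set \<Rightarrow> bool" where
  "winning P W X \<longleftrightarrow> X \<subseteq> P \<and> X \<in> W"

definition losing :: "'a set \<Rightarrow> 'a set set \<Rightarrow> 'a set \<Rightarrow> bool" where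
  "losing P W X \<longleftrightarrow> X \<subseteq> P \<and> X \<notin> W"

definition roughly_weighted :: "'a set \<Rightarrow> 'a set set \<Rightarrow> bool" where
  "roughly_weighted P W \<longleftrightarrow>
     (\<exists>(w :: 'a \<Rightarrow> real) (q :: real).
        (\<forall>i\<in>P. 0 \<le> w i) \<and>
        ((\<exists>i\<in>P. w i \<noteq> 0) \<or> q \<noteq> 0) \<and>
        (\<forall>X. X \<subseteq> P \<longrightarrow>
           ((\<Sum>i\<in>X. w i) < q \<longrightarrow> losing P W X) \<and>
           ((\<Sum>i\<in>X. w i) > q \<longrightarrow> winning P W X)))"

text \<open>The coalitions of a trading transform form sequences and may therefore repeat.\<close>

definition trading_transform :: "'a set \<Rightarrow> nat \<Rightarrow> 'a set list \<Rightarrow> 'a set list \<Rightarrow> bool" where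
  "trading_transform P j Xs Ys \<longleftrightarrow>
     length Xs = j \<and> length Ys = j \<and>
     (\<forall>X\<in>set Xs. X \<subseteq> P) \<and> (\<forall>Y\<in>set Ys. Y \<subseteq> P) \<and>
     (\<forall>i\<in>P. card {k. k < j \<and> i \<in> Xs ! k} = card {k. k < j \<and> i \<in> Ys ! k})"

definition certificate_of_nonweightedness ::
    "'a set \<Rightarrow> 'a set set \<Rightarrow> nat \<Rightarrow> 'a set list \<Rightarrow> 'a set list \<Rightarrow> bool" where
  "certificate_of_nonweightedness P W j Xs Ys \<longleftrightarrow>
     trading_transform P j Xs Ys \<and>
     (\<forall>X\<in>set Xs. winning P W X) \<and> (\<forall>Y\<in>set Ys. losing P W Y)"

definition potent_certificate ::
    "'a set \<Rightarrow> 'a set set \<Rightarrow> nat \<Rightarrow> 'a set list \<Rightarrow> 'a set list \<Rightarrow> bool" where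
  "potent_certificate P W j Xs Ys \<longleftrightarrow>
     certificate_of_nonweightedness P W j Xs Ys \<and> P \<in> set Xs \<and> {} \<in> set Ys"

text \<open>The infimum in \<^typ>\<open>enat\<close> is attained on non-empty sets and is \<open>\<infinity>\<close> on the empty set.\<close>

definition g_game :: "'a set \<Rightarrow> 'a set set \<Rightarrow> enat" where
  "g_game P W =
     (if roughly_weighted P W then \<infinity>
      else Inf {enat j |j. \<exists>Xs Ys. potent_certificate P W j Xs Ys})"

text \<open>There are only finitely many games on \<open>{1..n}\<close>, so the maximum ranges over a finite set.
  It is unspecified when that set is empty, i.e. when all games with \<open>n\<close> players are roughly weighted.\<close>

definition g :: "nat \<Rightarrow> enat" where
  "g n = Max {g_game {1..n} W |W. simple_game {1..n} W \<and> \<not> roughly_weighted {1..n} W}"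

end

theory Submission
  imports Defs "Jordan_Normal_Form.Determinant" "HOL-Library.Function_Algebras"
begin

text \<open>Upper bound: by Farkas' lemma, if no rough weights exist, then the vector \<open>(-1, \<dots>, -1)\<close> is a
  non-negative combination of differences \<open>X - Y\<close> (\<open>X\<close> winning, \<open>Y\<close> losing) and unit vectors, by
  Caratheodory's theorem even of a basis of such vectors. Cramer's rule makes it a combination with
  integer coefficients that are determinants with entries in \<open>{-1, 0, 1}\<close>, hence at most
  \<open>n ^ (n / 2)\<close> by Hadamard's inequality. Dropping the unit vectors and adding \<open>(P; \<emptyset>)\<close> as often as
  the right-hand side demands yields sequences in which every player occurs in at most as many
  winning as losing coalitions; shrinking the losing ones gives a potent certificate.

  Lower bound: if all winning coalitions have weight at least \<open>q\<close> and all losing ones at most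
  \<open>q + 1\<close>, then every potent certificate is longer than the total weight. The game below has such
  weights with total \<open>2 * n + 2\<close>, but admits no rough weights.\<close>

section \<open>Hadamard's inequality\<close>

text \<open>The Gram matrix \<open>A * transpose_mat A\<close> has determinant
  \<open>(det A)\<^sup>2\<close>; orthogonality makes it triangular with the squared row norms on
  its diagonal.\<close>

lemma det_orthogonal_rows:
  fixes A :: "real mat"
  assumes A: "A \<in> carrier_mat n n"
    and orth: "\<And>i j. i < j \<Longrightarrow> j < n \<Longrightarrow> row A i \<bullet> row A j = 0"
  shows "(det A)\<^sup>2 = (\<Prod>i<n. row A i \<bullet> row A i)"
proof -
  let ?G = "A * transpose_mat A"
  have G: "?G \<in> carrier_mat n n" using A by auto
  have entry: "?G $$ (i, j) = row A i \<bullet> row A j" if "i < n" "j < n" for i j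
    using A that by simp
  have "upper_triangular ?G"
  proof (rule upper_triangularI)
    fix i j assume ij: "j < i" "i < dim_row ?G"
    then have "row A j \<bullet> row A i = 0" using orth A by auto
    then show "?G $$ (i, j) = 0"
      using ij A entry[of i j] comm_scalar_prod[of "row A i" n "row A j"] by auto
  qed
  then have "det ?G = prod_list (diag_mat ?G)"
    using det_upper_triangular[OF _ G] by simp
  also have "\<dots> = (\<Prod>i<n. ?G $$ (i, i))"
    using A by (simp add: prod_list_diag_prod lessThan_atLeast0)
  also have "\<dots> = (\<Prod>i<n. row A i \<bullet> row A i)"
    using entry by simp
  finally show ?thesis
    using det_mult[OF A, of "transpose_mat A"] det_transpose[OF A] A
    by (simp add: power2_eq_square)
qed

text \<open>Gram-Schmidt without normalization: subtracting the projection onto an earlier row is an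
  elementary row operation, so it preserves the determinant, and it never lengthens a row.\<close>

lemma orthogonalize_rows:
  fixes A :: "real mat"
  assumes A: "A \<in> carrier_mat n n" and "m \<le> n"
  shows "\<exists>B \<in> carrier_mat n n. det B = det A \<and>
    (\<forall>k<n. row B k \<bullet> row B k \<le> row A k \<bullet> row A k) \<and>
    (\<forall>i j. i < j \<longrightarrow> j < m \<longrightarrow> row B i \<bullet> row B j = 0)"
  using \<open>m \<le> n\<close>
proof (induction m)
  case 0
  then show ?case using A by (intro bexI[of _ A]) auto
next
  case (Suc m)
  have mn: "m < n" using Suc.prems by simp
  \<comment> \<open>Inner induction: row \<open>m\<close> is made orthogonal to the first
    \<open>l\<close> rows, one row at a time, while the first \<open>m\<close> rows stay
    fixed.\<close>
  have "\<exists>B \<in> carrier_mat n n. det B = det A \<and>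
    (\<forall>k<n. row B k \<bullet> row B k \<le> row A k \<bullet> row A k) \<and>
    (\<forall>i j. i < j \<longrightarrow> j < m \<longrightarrow> row B i \<bullet> row B j = 0) \<and>
    (\<forall>i<l. row B i \<bullet> row B m = 0)" if "l \<le> m" for l
    using that
  proof (induction l)
    case 0
    then show ?case using Suc.IH mn by (simp add: less_imp_le)
  next
    case (Suc l)
    then obtain B where B: "B \<in> carrier_mat n n" and detB: "det B = det A"
      and nB: "\<And>k. k < n \<Longrightarrow> row B k \<bullet> row B k \<le> row A k \<bullet> row A k"
      and oB: "\<And>i j. i < j \<Longrightarrow> j < m \<Longrightarrow> row B i \<bullet> row B j = 0"
      and oBm: "\<And>i. i < l \<Longrightarrow> row B i \<bullet> row B m = 0"
      by auto
    have lm: "l < m" and ln: "l < n" using Suc.prems mn by auto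
    define d where "d = row B l \<bullet> row B l"
    define e where "e = row B l \<bullet> row B m"
    define C where "C = addrow (- (e / d)) m l B"
    have C: "C \<in> carrier_mat n n" unfolding C_def using B by simp
    have rowC: "row C k = (if k = m then - (e / d) \<cdot>\<^sub>v row B l + row B m else row B k)"
      if "k < n" for k
      using that B mn ln by (intro eq_vecI) (auto simp: C_def)
    have carr: "row B k \<in> carrier_vec n" for k using B by auto
    have right: "x \<bullet> (c \<cdot>\<^sub>v row B l + row B m) = c * (x \<bullet> row B l) + x \<bullet> row B m"
      if "x \<in> carrier_vec n" for x c
      using that carr by (simp add: scalar_prod_add_distrib[of _ n])
    have left: "(c \<cdot>\<^sub>v row B l + row B m) \<bullet> x = c * (row B l \<bullet> x) + row B m \<bullet> x"
      if "x \<in> carrier_vec n" for x c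
      using that carr by (simp add: add_scalar_prod_distrib[of _ n] smult_scalar_prod_distrib[of _ n])
    \<comment> \<open>A zero row gives \<open>d = 0\<close>, and then \<open>e / d\<close> is 0 by
      convention. As \<open>e\<close> vanishes too, the projection formulas hold without a case
      distinction.\<close>
    have "e = 0" if "d = 0"
    proof -
      have "row B l $ i = 0" if "i < n" for i
        using that \<open>d = 0\<close> B ln unfolding d_def scalar_prod_def
        by (auto simp: sum_nonneg_eq_0_iff)
      then show ?thesis
        using B ln mn unfolding e_def scalar_prod_def by (intro sum.neutral) auto
    qed
    then have ed: "e / d * d = e" by auto
    have d0: "d \<ge> 0" unfolding d_def scalar_prod_def by (intro sum_nonneg) simp
    have sym: "row B m \<bullet> row B l = e"
      unfolding e_def by (rule comm_scalar_prod[OF carr carr])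
    have "row C m \<bullet> row C m = (e / d)\<^sup>2 * d - 2 * (e / d) * e + row B m \<bullet> row B m"
      unfolding rowC[OF mn] using carr
      by (simp add: right left sym d_def[symmetric] e_def[symmetric] power2_eq_square algebra_simps)
    also have "(e / d)\<^sup>2 * d - 2 * (e / d) * e = - (e\<^sup>2 / d)"
      by (simp add: field_simps power2_eq_square)
    also have "- (e\<^sup>2 / d) + row B m \<bullet> row B m \<le> row B m \<bullet> row B m"
      using d0 by simp
    finally have "row C m \<bullet> row C m \<le> row A m \<bullet> row A m"
      using nB[OF mn] by linarith
    then have nC: "\<forall>k<n. row C k \<bullet> row C k \<le> row A k \<bullet> row A k"
    proof (intro allI impI)
      fix k assume "k < n"
      then show "row C k \<bullet> row C k \<le> row A k \<bullet> row A k"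
        using \<open>row C m \<bullet> row C m \<le> row A m \<bullet> row A m\<close> nB[of k] rowC[of k] by (cases "k = m") auto
    qed
    have oC: "\<forall>i j. i < j \<longrightarrow> j < m \<longrightarrow> row C i \<bullet> row C j = 0"
      using oB rowC mn by auto
    have "row C i \<bullet> row C m = 0" if "i < Suc l" for i
    proof -
      have i: "i < n" "i \<noteq> m" using that lm mn by auto
      have "row C i \<bullet> row C m = - (e / d) * (row B i \<bullet> row B l) + row B i \<bullet> row B m"
        using rowC[OF mn] rowC[OF i(1)] i carr by (simp add: right)
      also have "\<dots> = 0"
      proof (cases "i = l")
        case True
        then show ?thesis using ed by (simp add: d_def[symmetric] e_def[symmetric])
      next
        case False
        then have "i < l" using that by simp
        then show ?thesis using oB[of i l] oBm[of i] lm by simp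
      qed
      finally show ?thesis .
    qed
    moreover have "det C = det A"
      unfolding C_def using det_addrow[OF ln _ B] lm detB by simp
    ultimately show ?case using C nC oC by (intro bexI[of _ C]) auto
  qed
  from this[of m] obtain B where "B \<in> carrier_mat n n" "det B = det A"
      "\<forall>k<n. row B k \<bullet> row B k \<le> row A k \<bullet> row A k"
      "\<forall>i j. i < j \<longrightarrow> j < m \<longrightarrow> row B i \<bullet> row B j = 0" "\<forall>i<m. row B i \<bullet> row B m = 0"
    by auto
  then show ?case by (intro bexI[of _ B]) (auto simp: less_Suc_eq)
qed

lemma hadamard_inequality:
  fixes A :: "real mat"
  assumes "A \<in> carrier_mat n n"
  shows "(det A)\<^sup>2 \<le> (\<Prod>i<n. row A i \<bullet> row A i)"
proof -
  obtain B where B: "B \<in> carrier_mat n n" and det: "det B = det A"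
    and norm: "\<And>k. k < n \<Longrightarrow> row B k \<bullet> row B k \<le> row A k \<bullet> row A k"
    and orth: "\<And>i j. i < j \<Longrightarrow> j < n \<Longrightarrow> row B i \<bullet> row B j = 0"
    using orthogonalize_rows[OF assms order_refl] by auto
  have "(det A)\<^sup>2 = (\<Prod>i<n. row B i \<bullet> row B i)"
    using det_orthogonal_rows[OF B orth] det by simp
  also have "\<dots> \<le> (\<Prod>i<n. row A i \<bullet> row A i)"
    using norm by (intro prod_mono) (auto simp: scalar_prod_def intro!: sum_nonneg)
  finally show ?thesis .
qed

lemma det_square_le_power:
  fixes A :: "real mat"
  assumes A: "A \<in> carrier_mat n n"
    and le: "\<And>i j. i < n \<Longrightarrow> j < n \<Longrightarrow> \<bar>A $$ (i, j)\<bar> \<le> 1"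
  shows "(det A)\<^sup>2 \<le> real n ^ n"
proof -
  have "row A i \<bullet> row A i \<le> real n" if "i < n" for i
  proof -
    have "row A i \<bullet> row A i = (\<Sum>j<n. (A $$ (i, j))\<^sup>2)"
      using A that by (simp add: scalar_prod_def power2_eq_square lessThan_atLeast0)
    also have "\<dots> \<le> (\<Sum>j<n. 1)"
      using le[OF that] by (intro sum_mono) (simp add: abs_square_le_1)
    finally show ?thesis by simp
  qed
  then have "(\<Prod>i<n. row A i \<bullet> row A i) \<le> (\<Prod>i<n. real n)"
    by (intro prod_mono) (auto simp: scalar_prod_def intro!: sum_nonneg)
  then show ?thesis using hadamard_inequality[OF A] by simp
qed

section \<open>Bounded conic combinations\<close>

text \<open>Bartl's induction on the number of inequalities: if \<open>b\<close> is negative at some \<open>y\<close> allowed by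
  all inequalities but the \<open>j\<close>-th, scaled so that \<open>a j\<close> takes the value \<open>-1\<close> at \<open>y\<close>, then adding
  multiples of \<open>a j\<close> to the other functionals makes them vanish at \<open>y\<close>.\<close>

lemma farkas:
  fixes a :: "'i \<Rightarrow> 'p \<Rightarrow> real"
  assumes "finite I" "finite P"
    and "\<And>x. (\<forall>i\<in>I. 0 \<le> (\<Sum>p\<in>P. a i p * x p)) \<Longrightarrow> 0 \<le> (\<Sum>p\<in>P. b p * x p)"
  shows "\<exists>c. (\<forall>i\<in>I. 0 \<le> c i) \<and> (\<forall>p\<in>P. b p = (\<Sum>i\<in>I. c i * a i p))"
  using assms(1,3)
proof (induction I arbitrary: a b rule: finite_induct)
  case empty
  \<comment> \<open>Without constraints the test vector \<open>- b\<close> is admissible and forces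
    \<open>b\<close> to vanish on \<open>P\<close>.\<close>
  have "0 \<le> (\<Sum>p\<in>P. b p * - b p)" using empty[of "\<lambda>p. - b p"] by simp
  then have "(\<Sum>p\<in>P. b p * b p) \<le> 0" by (simp add: sum_negf)
  then have "(\<Sum>p\<in>P. b p * b p) = 0"
    by (intro antisym sum_nonneg) auto
  then have "\<forall>p\<in>P. b p = 0"
    using assms(2) by (simp add: sum_nonneg_eq_0_iff)
  then show ?case by simp
next
  case (insert j I)
  define D where "D u x = (\<Sum>p\<in>P. u p * x p)" for u x :: "'p \<Rightarrow> real"
  have Dlin1: "D (\<lambda>p. u p + r * v p) x = D u x + r * D v x" for u v x r
    unfolding D_def by (simp add: algebra_simps sum.distrib sum_distrib_left)
  have Dlin2: "D u (\<lambda>p. x p + r * y p) = D u x + r * D u y" for u x y r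
    unfolding D_def by (simp add: algebra_simps sum.distrib sum_distrib_left)
  have Dscale: "D u (\<lambda>p. r * y p) = r * D u y" for u y r
    unfolding D_def by (simp add: algebra_simps sum_distrib_left)
  have hyp: "0 \<le> D b x" if "0 \<le> D (a j) x" "\<And>i. i \<in> I \<Longrightarrow> 0 \<le> D (a i) x" for x
    using insert.prems[of x] that unfolding D_def by simp
  show ?case
  proof (cases "\<forall>x. (\<forall>i\<in>I. 0 \<le> D (a i) x) \<longrightarrow> 0 \<le> D b x")
    case True
    then obtain c where c: "\<forall>i\<in>I. 0 \<le> c i" "\<forall>p\<in>P. b p = (\<Sum>i\<in>I. c i * a i p)"
      using insert.IH[of a b] unfolding D_def by blast
    have "(\<Sum>i\<in>I. (c(j := 0)) i * a i p) = (\<Sum>i\<in>I. c i * a i p)" for p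
      using insert.hyps by (intro sum.cong) auto
    then show ?thesis
      using c insert.hyps by (intro exI[of _ "c(j := 0)"]) simp
  next
    case False
    then obtain x where x: "\<And>i. i \<in> I \<Longrightarrow> 0 \<le> D (a i) x" and bx: "D b x < 0"
      by (auto simp: not_le)
    have jx: "D (a j) x < 0" using hyp[of x] x bx by fastforce
    define y where "y = (\<lambda>p. (- 1 / D (a j) x) * x p)"
    have yi: "0 \<le> D (a i) y" if "i \<in> I" for i
      unfolding y_def Dscale using x[OF that] jx by (simp add: divide_nonneg_neg mult_nonneg_nonneg)
    have yb: "D b y < 0"
      unfolding y_def Dscale using bx jx by (simp add: divide_neg_neg mult_pos_neg)
    have yj: "D (a j) y = -1" unfolding y_def Dscale using jx by simp
    define a' where "a' i = (\<lambda>p. a i p + D (a i) y * a j p)" for i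
    define b' where "b' = (\<lambda>p. b p + D b y * a j p)"
    have "0 \<le> D b' z" if z: "\<forall>i\<in>I. 0 \<le> D (a' i) z" for z
    proof -
      \<comment> \<open>Moving \<open>z\<close> along \<open>y\<close> annihilates
        \<open>a j\<close>; at the new point \<open>a i\<close> and \<open>b\<close> take the values
        that \<open>a' i\<close> and \<open>b'\<close> have at \<open>z\<close>.\<close>
      let ?z = "\<lambda>p. z p + D (a j) z * y p"
      have "D (a j) ?z = 0" unfolding Dlin2 yj by simp
      moreover have "D (a i) ?z = D (a' i) z" for i
        unfolding Dlin2 a'_def Dlin1 by simp
      moreover have "D b ?z = D b' z"
        unfolding Dlin2 b'_def Dlin1 by simp
      ultimately show ?thesis using hyp[of ?z] z by simp
    qed
    then obtain c where c: "\<forall>i\<in>I. 0 \<le> c i" "\<forall>p\<in>P. b' p = (\<Sum>i\<in>I. c i * a' i p)"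
      using insert.IH[of a' b'] unfolding D_def by blast
    \<comment> \<open>Expanding \<open>a'\<close> and \<open>b'\<close> and collecting all multiples
      of \<open>a j\<close> gives this coefficient; it is nonnegative because
      \<open>D b y < 0\<close>.\<close>
    define e where "e = (\<Sum>i\<in>I. c i * D (a i) y) - D b y"
    have "0 \<le> (\<Sum>i\<in>I. c i * D (a i) y)"
      using c(1) yi by (intro sum_nonneg) simp
    then have e: "0 \<le> e" unfolding e_def using yb by simp
    have "b p = e * a j p + (\<Sum>i\<in>I. c i * a i p)" if "p \<in> P" for p
    proof -
      have "b p + D b y * a j p = (\<Sum>i\<in>I. c i * a i p) + (\<Sum>i\<in>I. c i * D (a i) y) * a j p"
        using c(2) that unfolding b'_def a'_def
        by (simp add: algebra_simps sum.distrib sum_distrib_left)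
      then show ?thesis unfolding e_def by (simp add: algebra_simps)
    qed
    moreover have "(\<Sum>i\<in>I. (c(j := e)) i * a i p) = (\<Sum>i\<in>I. c i * a i p)" for p
      using insert.hyps by (intro sum.cong) auto
    ultimately show ?thesis
      using c(1) e insert.hyps by (intro exI[of _ "c(j := e)"]) simp
  qed
qed

section \<open>Caratheodory's theorem and bases in spaces of real functions\<close>

interpretation real_fun: vector_space "\<lambda>c (f :: 'a \<Rightarrow> real) x. c * f x"
  by unfold_locales (auto simp: fun_eq_iff algebra_simps)

lemma sum_fun_apply: "(\<Sum>v\<in>S. f v) x = (\<Sum>v\<in>S. f v x)"
  for f :: "'b \<Rightarrow> 'a \<Rightarrow> real"
  by (induction S rule: infinite_finite_induct) auto

text \<open>Along a linear relation in \<open>T\<close> the coefficients can be shifted until one of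
  them reaches 0 while all stay nonnegative. This discards a vector, and the process ends at an
  independent set.\<close>

lemma conic_caratheodory:
  fixes T :: "('a \<Rightarrow> real) set"
  assumes "finite T" "\<And>v. v \<in> T \<Longrightarrow> 0 \<le> c v"
  shows "\<exists>B d. B \<subseteq> T \<and> \<not> real_fun.dependent B \<and> (\<forall>v\<in>B. 0 \<le> d v) \<and>
    (\<forall>p. (\<Sum>v\<in>T. c v * v p) = (\<Sum>v\<in>B. d v * v p))"
  using assms
proof (induction T arbitrary: c rule: finite_psubset_induct)
  case (psubset T)
  show ?case
  proof (cases "real_fun.dependent T")
    case False
    then show ?thesis using psubset.prems by (intro exI[of _ T] exI[of _ c]) auto
  next
    case True
    then obtain u0 w where u0: "w \<in> T" "u0 w \<noteq> 0" "(\<Sum>v\<in>T. (\<lambda>x. u0 v * v x)) = 0"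
      using real_fun.dependent_finite[OF psubset.hyps] by auto
    \<comment> \<open>The sign is chosen so that \<open>u w > 0\<close>; hence some coefficient
      decreases along the relation.\<close>
    define u where "u v = sgn (u0 w) * u0 v" for v
    have u: "(\<Sum>v\<in>T. u v * v p) = 0" for p
    proof -
      have "(\<Sum>v\<in>T. u0 v * v p) = 0"
        using fun_cong[OF u0(3), of p] by (simp add: sum_fun_apply)
      then show ?thesis by (simp add: u_def mult.assoc flip: sum_distrib_left)
    qed
    \<comment> \<open>Ratio test: the minimal quotient is the longest shift that keeps every
      coefficient nonnegative, and it cancels the coefficient of \<open>v\<close>.\<close>
    let ?S = "{v \<in> T. 0 < u v}"
    have "finite ?S" "w \<in> ?S"
      using psubset.hyps u0 by (auto simp: u_def sgn_if)
    then obtain v where "v \<in> ?S" and "\<not> (\<exists>y\<in>?S. c y / u y < c v / u v)"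
      using arg_min_if_finite[of ?S "\<lambda>v. c v / u v"] by blast
    then have v: "v \<in> T" "0 < u v"
      and vmin: "\<And>y. y \<in> T \<Longrightarrow> 0 < u y \<Longrightarrow> c v / u v \<le> c y / u y"
      by (auto simp: not_less)
    define \<theta> where "\<theta> = c v / u v"
    define d where "d y = c y - \<theta> * u y" for y
    have "\<theta> \<ge> 0" using v psubset.prems by (simp add: \<theta>_def)
    have d: "0 \<le> d y" if "y \<in> T" for y
    proof (cases "0 < u y")
      case True
      then show ?thesis using vmin[OF that True] by (simp add: d_def \<theta>_def pos_le_divide_eq)
    next
      case False
      then have "\<theta> * u y \<le> 0" using \<open>\<theta> \<ge> 0\<close> by (simp add: mult_nonneg_nonpos)
      then show ?thesis using psubset.prems[OF that] by (simp add: d_def)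
    qed
    have "d v = 0" using v by (simp add: d_def \<theta>_def)
    have eq: "(\<Sum>y\<in>T. c y * y p) = (\<Sum>y\<in>T - {v}. d y * y p)" for p
    proof -
      have "(\<Sum>y\<in>T. c y * y p) = (\<Sum>y\<in>T. c y * y p) - \<theta> * (\<Sum>y\<in>T. u y * y p)"
        using u by simp
      also have "\<dots> = (\<Sum>y\<in>T. d y * y p)"
        by (simp add: d_def algebra_simps sum_subtractf sum_distrib_left)
      also have "\<dots> = (\<Sum>y\<in>T - {v}. d y * y p)"
        using v(1) \<open>d v = 0\<close> psubset.hyps by (simp add: sum.remove)
      finally show ?thesis .
    qed
    show ?thesis
      using psubset.IH[of "T - {v}" d] d v(1) unfolding eq by blast
  qed
qed

text \<open>Since \<open>T\<close> is supported on \<open>P\<close>, the unit vectors in it form a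
  basis of its span, of size \<open>card P\<close>. A maximal independent set between
  \<open>B\<close> and \<open>T\<close> is another basis, so it has the same size. This makes the
  later coefficient matrix square.\<close>

lemma independent_extend_to_card:
  fixes T :: "('a \<Rightarrow> real) set"
  assumes P: "finite P"
    and supp: "\<And>v p. v \<in> T \<Longrightarrow> p \<notin> P \<Longrightarrow> v p = 0"
    and unit: "\<And>i. i \<in> P \<Longrightarrow> (\<lambda>p. of_bool (p = i)) \<in> T"
    and B: "B \<subseteq> T" "\<not> real_fun.dependent B"
  obtains C where "B \<subseteq> C" "C \<subseteq> T" "\<not> real_fun.dependent C" "card C = card P"
proof -
  define e where "e i = (\<lambda>p. of_bool (p = i) :: real)" for i :: 'a
  have inj: "inj_on e P"
  proof (rule inj_onI)
    fix i j assume "e i = e j"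
    then have "e i i = e j i" by simp
    then show "i = j" by (simp add: e_def split: if_splits)
  qed
  have comb: "(\<Sum>v\<in>e ` P. (\<lambda>x. u v * v x)) = (\<lambda>x. if x \<in> P then u (e x) else 0)" for u
  proof
    fix x
    have "(\<Sum>v\<in>e ` P. (\<lambda>x. u v * v x)) x = (\<Sum>i\<in>P. u (e i) * e i x)"
      by (simp add: sum_fun_apply sum.reindex[OF inj])
    also have "\<dots> = (\<Sum>i\<in>P. if i = x then u (e x) else 0)"
      by (intro sum.cong) (auto simp: e_def)
    finally show "(\<Sum>v\<in>e ` P. (\<lambda>x. u v * v x)) x = (if x \<in> P then u (e x) else 0)"
      using P by simp
  qed
  have indep: "\<not> real_fun.dependent (e ` P)"
  proof
    assume "real_fun.dependent (e ` P)"
    then obtain u i where i: "i \<in> P" "u (e i) \<noteq> 0"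
      and "(\<Sum>v\<in>e ` P. (\<lambda>x. u v * v x)) = 0"
      using P by (auto simp: real_fun.dependent_finite)
    then have "(\<lambda>x. if x \<in> P then u (e x) else 0) = 0" unfolding comb by simp
    from fun_cong[OF this, of i] show False using i by simp
  qed
  have span: "T \<subseteq> real_fun.span (e ` P)"
  proof
    fix v assume v: "v \<in> T"
    have "v = (\<Sum>w\<in>e ` P. (\<lambda>x. v (inv_into P e w) * w x))"
      unfolding comb using supp[OF v] inj by (auto simp: fun_eq_iff)
    also have "\<dots> \<in> real_fun.span (e ` P)"
      by (intro real_fun.span_sum real_fun.span_scale real_fun.span_base)
    finally show "v \<in> real_fun.span (e ` P)" .
  qed
  have "e ` P \<subseteq> T" using unit by (auto simp: e_def)
  then have "real_fun.dim T = card P"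
    using real_fun.basis_card_eq_dim[OF _ span indep] card_image[OF inj] by simp
  moreover obtain C where C: "B \<subseteq> C" "C \<subseteq> T" "\<not> real_fun.dependent C" "T \<subseteq> real_fun.span C"
    using real_fun.maximal_independent_subset_extend[OF B] by blast
  moreover have "card C = real_fun.dim T"
    using real_fun.basis_card_eq_dim[OF C(2,4,3)] .
  ultimately show thesis using that by simp
qed

section \<open>Integer coefficients by Cramer's rule\<close>

lemma det_in_Ints:
  fixes A :: "'a :: comm_ring_1 mat"
  assumes "A \<in> carrier_mat n n" "\<And>i j. i < n \<Longrightarrow> j < n \<Longrightarrow> A $$ (i, j) \<in> \<int>"
  shows "det A \<in> \<int>"
  unfolding det_def'[OF assms(1)]
  by (intro Ints_sum Ints_mult Ints_prod) (auto simp: sign_def intro!: assms dest: permutes_in_image)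

lemma abs_Ints_eq_nat:
  fixes x :: real
  assumes "x \<in> \<int>"
  obtains k :: nat where "\<bar>x\<bar> = real k"
proof -
  obtain z where "x = of_int z" using assms by (rule Ints_cases)
  then have "\<bar>x\<bar> = real (nat \<bar>z\<bar>)" by simp
  then show thesis by (rule that)
qed

text \<open>Over a basis drawn from \<open>T\<close>, Cramer's rule writes each coefficient as a
  quotient of determinants with entries in {-1, 0, 1}. Their absolute values are integers bounded by
  Hadamard: \<open>D\<close> is the common denominator, and the \<open>m v\<close> are the
  numerators.\<close>

lemma bounded_conic_combination:
  fixes T :: "(nat \<Rightarrow> real) set"
  assumes T: "finite T"
    and supp: "\<And>v p. v \<in> T \<Longrightarrow> p \<notin> {1..n} \<Longrightarrow> v p = 0"
    and entry: "\<And>v p. v \<in> T \<Longrightarrow> v p \<in> {-1, 0, 1}"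
    and unit: "\<And>i. i \<in> {1..n} \<Longrightarrow> (\<lambda>p. of_bool (p = i)) \<in> T"
    and b: "\<And>p. p \<in> {1..n} \<Longrightarrow> b p \<in> {-1, 0, 1}"
    and c: "\<And>v. v \<in> T \<Longrightarrow> 0 \<le> c v"
    and comb: "\<And>p. p \<in> {1..n} \<Longrightarrow> b p = (\<Sum>v\<in>T. c v * v p)"
  shows "\<exists>B D (m :: _ \<Rightarrow> nat). B \<subseteq> T \<and> card B = n \<and> 0 < D \<and> (real D)\<^sup>2 \<le> real n ^ n \<and>
    (\<forall>v\<in>B. (real (m v))\<^sup>2 \<le> real n ^ n) \<and>
    (\<forall>p\<in>{1..n}. real D * b p = (\<Sum>v\<in>B. real (m v) * v p))"
proof -
  obtain B0 d0 where B0: "B0 \<subseteq> T" "\<not> real_fun.dependent B0" "\<forall>v\<in>B0. 0 \<le> d0 v"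
    and d0: "\<forall>p. (\<Sum>v\<in>T. c v * v p) = (\<Sum>v\<in>B0. d0 v * v p)"
    using conic_caratheodory[of T c, OF T c] by blast
  obtain B where B: "B0 \<subseteq> B" "B \<subseteq> T" "\<not> real_fun.dependent B" "card B = n"
    by (rule independent_extend_to_card[of "{1..n}" T B0]) (use supp unit B0 that in auto)
  have finB: "finite B" using B(2) T by (rule finite_subset)
  \<comment> \<open>Vectors added to complete the basis receive coefficient 0.\<close>
  define d where "d v = (if v \<in> B0 then d0 v else 0)" for v
  have d_nonneg: "0 \<le> d v" for v using B0(3) by (simp add: d_def)
  have d: "b p = (\<Sum>v\<in>B. d v * v p)" if "p \<in> {1..n}" for p
  proof -
    have "(\<Sum>v\<in>B. d v * v p) = (\<Sum>v\<in>B0. d0 v * v p)"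
      using finB B(1) by (intro sum.mono_neutral_cong_right) (auto simp: d_def)
    then show ?thesis using comb[OF that] d0 by simp
  qed
  obtain f where f: "bij_betw f {0..<n} B"
    using ex_bij_betw_nat_finite[OF finB] B(4) by auto
  have fT: "f j \<in> T" if "j < n" for j using f that B(2) by (auto simp: bij_betw_def)
  have sumB: "(\<Sum>v\<in>B. h v) = (\<Sum>j=0..<n. h (f j))" for h :: "_ \<Rightarrow> real"
    using sum.reindex_bij_betw[OF f, of h] by simp
  \<comment> \<open>The basis vectors are the columns; \<open>Suc\<close> shifts the matrix indices,
    which start at 0, to players, which start at 1.\<close>
  define A where "A = mat n n (\<lambda>(i, j). f j (Suc i))"
  define x where "x = vec n (\<lambda>j. d (f j))"
  define \<beta> where "\<beta> = vec n (\<lambda>i. b (Suc i))"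
  have A: "A \<in> carrier_mat n n" and x: "x \<in> carrier_vec n" by (auto simp: A_def x_def)
  have Ax: "A *\<^sub>v x = \<beta>"
  proof (rule eq_vecI)
    fix i assume "i < dim_vec \<beta>"
    then have i: "i < n" by (simp add: \<beta>_def)
    then have "(A *\<^sub>v x) $ i = (\<Sum>j=0..<n. d (f j) * f j (Suc i))"
      by (simp add: A_def x_def scalar_prod_def mult.commute)
    also have "\<dots> = b (Suc i)" using d[of "Suc i"] i by (simp add: sumB)
    finally show "(A *\<^sub>v x) $ i = \<beta> $ i" using i by (simp add: \<beta>_def)
  qed (simp add: A_def \<beta>_def)
  \<comment> \<open>A kernel vector of \<open>A\<close> would be a linear relation in
    \<open>B\<close>, because the vectors of \<open>B\<close> vanish outside {1..n}.\<close>
  have "det A \<noteq> 0"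
  proof
    assume "det A = 0"
    then obtain y where y: "y \<in> carrier_vec n" "y \<noteq> 0\<^sub>v n" "A *\<^sub>v y = 0\<^sub>v n"
      using det_0_iff_vec_prod_zero_field[OF A] by auto
    define u where "u v = y $ inv_into {0..<n} f v" for v
    have uf: "u (f j) = y $ j" if "j < n" for j
      using f that by (simp add: u_def bij_betw_def)
    have "(\<Sum>v\<in>B. u v * v p) = 0" for p
    proof (cases "p \<in> {1..n}")
      case True
      then obtain i where i: "p = Suc i" "i < n" by (cases p) auto
      have "(\<Sum>v\<in>B. u v * v p) = (A *\<^sub>v y) $ i"
        using i y(1) by (auto simp: sumB A_def scalar_prod_def uf mult.commute intro!: sum.cong)
      then show ?thesis using y(3) i by simp
    next
      case False
      then show ?thesis using supp B(2) by (intro sum.neutral) auto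
    qed
    then have "(\<Sum>v\<in>B. (\<lambda>p. u v * v p)) = 0"
      by (auto simp: fun_eq_iff sum_fun_apply)
    then have "\<forall>v\<in>B. u v = 0" using B(3) finB by (auto simp: real_fun.dependent_finite)
    then have "y $ j = 0" if "j < n" for j
      using uf[OF that] f that by (auto simp: bij_betw_def)
    then show False using y(1,2) by (auto intro: eq_vecI)
  qed
  define R where "R k = replace_col A \<beta> k" for k
  have R: "R k \<in> carrier_mat n n" for k using A by (simp add: R_def replace_col_def)
  have entryA: "A $$ (i, j) \<in> {-1, 0, 1}" if "i < n" "j < n" for i j
    using that entry[OF fT] by (simp add: A_def)
  have entryR: "R k $$ (i, j) \<in> {-1, 0, 1}" if "i < n" "j < n" for i j k
    using that entryA[OF that] b[of "Suc i"] A by (simp add: R_def replace_col_def \<beta>_def)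
  have det: "\<exists>k :: nat. \<bar>det M\<bar> = real k \<and> (real k)\<^sup>2 \<le> real n ^ n"
    if M: "M \<in> carrier_mat n n" and ent: "\<And>i j. i < n \<Longrightarrow> j < n \<Longrightarrow> M $$ (i, j) \<in> {-1, 0, 1}"
    for M :: "real mat"
  proof -
    have "M $$ (i, j) \<in> \<int>" "\<bar>M $$ (i, j)\<bar> \<le> 1" if "i < n" "j < n" for i j
      using ent[OF that] by auto
    then have "det M \<in> \<int>" "(det M)\<^sup>2 \<le> real n ^ n"
      using det_in_Ints[OF M] det_square_le_power[OF M] by auto
    obtain k where k: "\<bar>det M\<bar> = real k" using abs_Ints_eq_nat[OF \<open>det M \<in> \<int>\<close>] .
    have "(real k)\<^sup>2 = (det M)\<^sup>2" unfolding k[symmetric] by (rule power2_abs)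
    then show ?thesis using k \<open>(det M)\<^sup>2 \<le> real n ^ n\<close> by (intro exI[of _ k]) simp
  qed
  obtain D where D: "\<bar>det A\<bar> = real D" "(real D)\<^sup>2 \<le> real n ^ n"
    using det[OF A entryA] by auto
  have "\<exists>q :: nat. \<bar>det (R k)\<bar> = real q \<and> (real q)\<^sup>2 \<le> real n ^ n" for k
    by (rule det[OF R entryR])
  then have "\<forall>k. \<exists>q :: nat. \<bar>det (R k)\<bar> = real q \<and> (real q)\<^sup>2 \<le> real n ^ n" ..
  then obtain r where "\<forall>k. \<bar>det (R k)\<bar> = real (r k) \<and> (real (r k))\<^sup>2 \<le> real n ^ n"
    by (rule choice[THEN exE])
  then have r: "\<bar>det (R k)\<bar> = real (r k)" "(real (r k))\<^sup>2 \<le> real n ^ n" for k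
    by simp_all
  define m where "m v = r (inv_into {0..<n} f v)" for v
  \<comment> \<open>As the coefficients \<open>d\<close> are nonnegative, Cramer's rule survives
    taking absolute values on both sides.\<close>
  have mf: "real (m (f j)) = real D * d (f j)" if "j < n" for j
  proof -
    have "m (f j) = r j" using f that by (simp add: m_def bij_betw_def)
    moreover have "det (R j) = x $ j * det A"
      using cramer_lemma_mat[OF A x that] Ax by (simp add: R_def)
    then have "\<bar>det (R j)\<bar> = d (f j) * \<bar>det A\<bar>"
      using that d_nonneg by (simp add: x_def abs_mult)
    ultimately show ?thesis using r(1)[of j] D(1) by simp
  qed
  have "real D * b p = (\<Sum>v\<in>B. real (m v) * v p)" if "p \<in> {1..n}" for p
    using mf by (simp add: d[OF that] sumB sum_distrib_left mult.assoc)
  moreover have "0 < D" using \<open>det A \<noteq> 0\<close> D(1) by (cases D) auto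
  moreover have "\<forall>v\<in>B. (real (m v))\<^sup>2 \<le> real n ^ n" using r(2) by (simp add: m_def)
  ultimately show ?thesis using B(2,4) D(2) by (intro exI[of _ B] exI[of _ D] exI[of _ m]) auto
qed

section \<open>Short potent certificates\<close>

text \<open>For each player, choose as many of its positions in \<open>Ys\<close> as it has in
  \<open>Xs\<close> and delete it from the others. Applied to losing coalitions, this keeps them
  losing.\<close>

lemma shrink_to_trading_transform:
  assumes len: "length Xs = j" "length Ys = j"
    and sub: "\<forall>X\<in>set Xs. X \<subseteq> P" "\<forall>Y\<in>set Ys. Y \<subseteq> P"
    and le: "\<And>i. i \<in> P \<Longrightarrow> card {k. k < j \<and> i \<in> Xs ! k} \<le> card {k. k < j \<and> i \<in> Ys ! k}"
  obtains Zs where "trading_transform P j Xs Zs" "\<And>k. k < j \<Longrightarrow> Zs ! k \<subseteq> Ys ! k"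
proof -
  have "\<forall>i\<in>P. \<exists>S. S \<subseteq> {k. k < j \<and> i \<in> Ys ! k} \<and> card S = card {k. k < j \<and> i \<in> Xs ! k}"
  proof
    fix i assume "i \<in> P"
    then show "\<exists>S. S \<subseteq> {k. k < j \<and> i \<in> Ys ! k} \<and> card S = card {k. k < j \<and> i \<in> Xs ! k}"
      by (rule obtain_subset_with_card_n[OF le]) blast
  qed
  then obtain S where S: "\<forall>i\<in>P. S i \<subseteq> {k. k < j \<and> i \<in> Ys ! k} \<and>
      card (S i) = card {k. k < j \<and> i \<in> Xs ! k}"
    by (rule bchoice[THEN exE])
  define Zs where "Zs = map (\<lambda>k. {i \<in> Ys ! k. k \<in> S i}) [0..<j]"
  have nth: "Zs ! k = {i \<in> Ys ! k. k \<in> S i}" if "k < j" for k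
    using that by (simp add: Zs_def)
  have "Zs ! k \<subseteq> P" if "k < j" for k
    using sub(2) len(2) that nth_mem[of k Ys] by (auto simp: nth)
  then have "\<forall>Z\<in>set Zs. Z \<subseteq> P" by (auto simp: in_set_conv_nth Zs_def)
  moreover have "card {k. k < j \<and> i \<in> Zs ! k} = card {k. k < j \<and> i \<in> Xs ! k}" if "i \<in> P" for i
  proof -
    have "k < j \<and> i \<in> Ys ! k" if "k \<in> S i" for k using S \<open>i \<in> P\<close> that by blast
    then have "{k. k < j \<and> i \<in> Zs ! k} = S i" using nth by auto
    then show ?thesis using S that by simp
  qed
  ultimately have "trading_transform P j Xs Zs"
    using len(1) sub(1) by (simp add: trading_transform_def Zs_def)
  then show thesis using that nth by auto
qed

lemma sum_of_bool_mem:
  fixes x :: "'a \<Rightarrow> real"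
  assumes "finite P" "X \<subseteq> P"
  shows "(\<Sum>p\<in>P. of_bool (p \<in> X) * x p) = sum x X"
  using assms by (intro sum.mono_neutral_cong_right) auto

text \<open>The quota is the least weight of a winning coalition: anything lighter loses by
  minimality, and anything heavier wins because no losing coalition outweighs a winning one.\<close>

lemma roughly_weighted_if_nonneg_on_pairs:
  fixes x :: "'a \<Rightarrow> real"
  assumes game: "simple_game P W"
    and nonneg: "\<And>p. p \<in> P \<Longrightarrow> 0 \<le> x p"
    and pair: "\<And>X Y. X \<in> W \<Longrightarrow> Y \<in> Pow P - W \<Longrightarrow> sum x Y \<le> sum x X"
    and nonzero: "\<exists>p\<in>P. x p \<noteq> 0"
  shows "roughly_weighted P W"
proof -
  have "finite W" "W \<noteq> {}"
    using game finite_subset[of W "Pow P"] by (auto simp: simple_game_def)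
  define q where "q = Min (sum x ` W)"
  have "q \<in> sum x ` W" unfolding q_def using \<open>finite W\<close> \<open>W \<noteq> {}\<close> by (intro Min_in) auto
  then obtain X0 where X0: "X0 \<in> W" "q = sum x X0" by auto
  have "losing P W X" if "X \<subseteq> P" "sum x X < q" for X
    using that \<open>finite W\<close> Min_le[of "sum x ` W" "sum x X"] by (fastforce simp: losing_def q_def)
  moreover have "winning P W X" if "X \<subseteq> P" "sum x X > q" for X
    using that pair[OF X0(1), of X] X0(2) by (force simp: winning_def)
  ultimately show ?thesis
    unfolding roughly_weighted_def using nonneg nonzero by blast
qed

lemma length_filter_concat_replicate:
  assumes "distinct L"
  shows "length (filter Q (concat (map (\<lambda>v. replicate (m v) (f v)) L))) =
    (\<Sum>v\<in>set L. m v * of_bool (Q (f v)))"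
  using assms by (induction L) (auto simp: filter_replicate)

lemma length_concat_replicate:
  assumes "distinct L"
  shows "length (concat (map (\<lambda>v. replicate (m v) (f v)) L)) = (\<Sum>v\<in>set L. m v)"
  using assms by (induction L) auto

lemma card_nth_eq_length_filter:
  "length Xs = j \<Longrightarrow> card {k. k < j \<and> i \<in> Xs ! k} = length (filter (\<lambda>X. i \<in> X) Xs)"
  by (simp add: length_filter_conv_card)

lemma exists_short_potent_certificate:
  assumes game: "simple_game {1..n} W" and nonrough: "\<not> roughly_weighted {1..n} W"
  shows "\<exists>j Xs Ys. potent_certificate {1..n} W j Xs Ys \<and> real j \<le> (real n + 1) * sqrt (real n ^ n)"
proof -
  define P where "P = {1..n}"
  have P: "finite P" by (simp add: P_def)
  have WP: "W \<subseteq> Pow P"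
    and up: "\<And>X Y. X \<in> W \<Longrightarrow> X \<subseteq> Y \<Longrightarrow> Y \<subseteq> P \<Longrightarrow> Y \<in> W"
    and nontriv: "W \<noteq> {}" "W \<noteq> Pow P"
    using game unfolding simple_game_def P_def by blast+
  have PW: "P \<in> W" using nontriv(1) WP up by blast
  have emptyW: "{} \<notin> W" using nontriv(2) WP up by blast
  define \<delta> where "\<delta> Z p = (of_bool (p \<in> fst Z) - of_bool (p \<in> snd Z) :: real)"
    for Z :: "nat set \<times> nat set" and p
  define S where "S = W \<times> (Pow P - W)"
  define E where "E = (\<lambda>i p. of_bool (p = i) :: real) ` P"
  define T where "T = \<delta> ` S \<union> E"
  have "finite W" using WP P by (simp add: finite_subset)
  then have "finite T" using P by (simp add: T_def S_def E_def)
  \<comment> \<open>The unit vectors \<open>E\<close> force a solution of the dual system to be non-negative, i.e. to be a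
    vector of rough weights. Being \<open>0/1\<close>-valued, they do not spoil the determinant bound.\<close>
  have "\<exists>c. (\<forall>v\<in>T. 0 \<le> c v) \<and> (\<forall>p\<in>P. -1 = (\<Sum>v\<in>T. c v * v p))"
  proof (rule farkas[OF \<open>finite T\<close> P])
    fix x :: "nat \<Rightarrow> real"
    assume x: "\<forall>v\<in>T. 0 \<le> (\<Sum>p\<in>P. v p * x p)"
    have nonneg: "0 \<le> x i" if "i \<in> P" for i
    proof -
      have "0 \<le> (\<Sum>p\<in>P. of_bool (p \<in> {i}) * x p)" using x that by (auto simp: T_def E_def)
      then show ?thesis using sum_of_bool_mem[OF P, of "{i}" x] that by simp
    qed
    have "sum x Y \<le> sum x X" if "X \<in> W" "Y \<in> Pow P - W" for X Y
    proof -
      have "0 \<le> (\<Sum>p\<in>P. \<delta> (X, Y) p * x p)" using x that by (auto simp: T_def S_def)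
      also have "\<dots> = sum x X - sum x Y"
        using sum_of_bool_mem[OF P, of X x] sum_of_bool_mem[OF P, of Y x] that WP
        by (auto simp: \<delta>_def left_diff_distrib sum_subtractf)
      finally show ?thesis by simp
    qed
    \<comment> \<open>A nonzero solution would be a vector of rough weights, so only 0 is left,
      where the required inequality is trivial.\<close>
    then have "\<forall>p\<in>P. x p = 0"
      using roughly_weighted_if_nonneg_on_pairs[OF game, of x] nonneg nonrough
      by (auto simp: P_def)
    then show "0 \<le> (\<Sum>p\<in>P. -1 * x p)" by simp
  qed
  then obtain c where c: "\<forall>v\<in>T. 0 \<le> c v" "\<forall>p\<in>P. -1 = (\<Sum>v\<in>T. c v * v p)" by blast
  have "\<exists>B D (m :: _ \<Rightarrow> nat). B \<subseteq> T \<and> card B = n \<and> 0 < D \<and> (real D)\<^sup>2 \<le> real n ^ n \<and>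
    (\<forall>v\<in>B. (real (m v))\<^sup>2 \<le> real n ^ n) \<and>
    (\<forall>p\<in>{1..n}. real D * -1 = (\<Sum>v\<in>B. real (m v) * v p))"
  proof (rule bounded_conic_combination[OF \<open>finite T\<close>, where c = c])
    show "v p = 0" if v: "v \<in> T" and p: "p \<notin> {1..n}" for v p
    proof -
      consider i where "i \<in> P" "v = (\<lambda>p. of_bool (p = i))" | Z where "Z \<in> S" "v = \<delta> Z"
        using v by (auto simp: T_def E_def)
      then show ?thesis
      proof cases
        case 1
        then show ?thesis using p by (auto simp: P_def)
      next
        case 2
        then have "fst Z \<subseteq> P" "snd Z \<subseteq> P" by (auto simp: S_def dest!: subsetD[OF WP])
        then have "p \<notin> fst Z" "p \<notin> snd Z" using p by (auto simp: P_def)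
        then show ?thesis using 2(2) by (simp add: \<delta>_def)
      qed
    qed
    show "v p \<in> {-1, 0, 1}" if "v \<in> T" for v p
      using that by (auto simp: T_def E_def \<delta>_def)
  qed (use c in \<open>auto simp: T_def E_def P_def\<close>)
  then obtain B D and m :: "_ \<Rightarrow> nat" where BT: "B \<subseteq> T" and cardB: "card B = n" and "0 < D"
    and D: "(real D)\<^sup>2 \<le> real n ^ n" and m: "\<forall>v\<in>B. (real (m v))\<^sup>2 \<le> real n ^ n"
    and comb: "\<forall>p\<in>{1..n}. real D * -1 = (\<Sum>v\<in>B. real (m v) * v p)"
    by blast
  \<comment> \<open>Everything in \<open>B - B1\<close> is a unit vector, so dropping it can only
    lower the sum: the equation for \<open>- D\<close> becomes the inequality
    \<open>comb1\<close>.\<close>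
  define B1 where "B1 = B \<inter> \<delta> ` S"
  have "finite B" using BT \<open>finite T\<close> by (rule finite_subset)
  then have "finite B1" by (simp add: B1_def)
  then obtain L where L: "set L = B1" "distinct L" using finite_distinct_list by blast
  \<comment> \<open>Several pairs of coalitions may have the same difference vector; one is picked
    for each.\<close>
  define Z where "Z = inv_into S \<delta>"
  have Z: "fst (Z v) \<in> W" "snd (Z v) \<in> Pow P - W" "\<delta> (Z v) = v" if "v \<in> B1" for v
    using that inv_into_into[of v \<delta> S] f_inv_into_f[of v \<delta> S]
    by (auto simp: B1_def Z_def S_def mem_Times_iff)
  have comb1: "real D + (\<Sum>v\<in>B1. real (m v) * v p) \<le> 0" if p: "p \<in> P" for p
  proof -
    have "0 \<le> (\<Sum>v\<in>B - B1. real (m v) * v p)"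
      using BT by (intro sum_nonneg) (auto simp: B1_def T_def E_def)
    moreover have "(\<Sum>v\<in>B. real (m v) * v p) = (\<Sum>v\<in>B - B1. real (m v) * v p) + (\<Sum>v\<in>B1. real (m v) * v p)"
      using \<open>finite B\<close> by (intro sum.subset_diff) (auto simp: B1_def)
    moreover have "(\<Sum>v\<in>B. real (m v) * v p) = - real D" using comb p by (simp add: P_def)
    ultimately show ?thesis by linarith
  qed
  \<comment> \<open>By \<open>comb1\<close> every player occurs at least \<open>D\<close> times more
    often in the chosen losing coalitions than in the winning ones, so \<open>D\<close> copies of
    \<open>P\<close> on the winning side are still compensated.\<close>
  define Xs where "Xs = replicate D P @ concat (map (\<lambda>v. replicate (m v) (fst (Z v))) L)"
  define Ys where "Ys = replicate D {} @ concat (map (\<lambda>v. replicate (m v) (snd (Z v))) L)"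
  define j where "j = D + (\<Sum>v\<in>B1. m v)"
  have len: "length Xs = j" "length Ys = j"
    using L by (simp_all only: Xs_def Ys_def j_def length_append length_replicate length_concat_replicate)
  have XsW: "\<forall>X\<in>set Xs. X \<in> W" using Z(1) PW L(1) by (auto simp: Xs_def)
  have "set Ys \<subseteq> insert {} ((\<lambda>v. snd (Z v)) ` B1)" using L(1) by (auto simp: Ys_def)
  then have YsW: "\<forall>Y\<in>set Ys. Y \<in> Pow P - W" using Z(2) emptyW by blast
  have le: "card {k. k < j \<and> i \<in> Xs ! k} \<le> card {k. k < j \<and> i \<in> Ys ! k}" if i: "i \<in> P" for i
  proof -
    have "card {k. k < j \<and> i \<in> Xs ! k} = D + (\<Sum>v\<in>B1. m v * of_bool (i \<in> fst (Z v)))"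
      unfolding card_nth_eq_length_filter[OF len(1)]
      using i L by (simp add: Xs_def length_filter_concat_replicate filter_replicate)
    moreover have "card {k. k < j \<and> i \<in> Ys ! k} = (\<Sum>v\<in>B1. m v * of_bool (i \<in> snd (Z v)))"
      unfolding card_nth_eq_length_filter[OF len(2)]
      using L by (simp add: Ys_def length_filter_concat_replicate filter_replicate)
    moreover have "(\<Sum>v\<in>B1. real (m v) * v i) =
        real (\<Sum>v\<in>B1. m v * of_bool (i \<in> fst (Z v))) - real (\<Sum>v\<in>B1. m v * of_bool (i \<in> snd (Z v)))"
    proof -
      have "(\<Sum>v\<in>B1. real (m v) * v i) = (\<Sum>v\<in>B1. real (m v) * \<delta> (Z v) i)"
        using Z(3) by (intro sum.cong) auto
      then show ?thesis by (simp add: \<delta>_def right_diff_distrib sum_subtractf)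
    qed
    ultimately show ?thesis using comb1[OF i] by linarith
  qed
  have XsP: "\<forall>X\<in>set Xs. X \<subseteq> P" using XsW WP by blast
  have YsP: "\<forall>Y\<in>set Ys. Y \<subseteq> P" using YsW by blast
  obtain Zs where Zs: "trading_transform P j Xs Zs" "\<And>k. k < j \<Longrightarrow> Zs ! k \<subseteq> Ys ! k"
    using shrink_to_trading_transform[OF len XsP YsP le] by blast
  have lenZ: "length Zs = j" using Zs(1) by (simp add: trading_transform_def)
  have "losing P W Y" if "Y \<in> set Zs" for Y
  proof -
    obtain k where k: "k < j" "Y = Zs ! k" using \<open>Y \<in> set Zs\<close> lenZ by (auto simp: in_set_conv_nth)
    then have "Ys ! k \<in> Pow P - W" using YsW len(2) nth_mem by blast
    moreover have "Y \<subseteq> Ys ! k" using Zs(2)[OF k(1)] k(2) by simp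
    ultimately show ?thesis using up unfolding losing_def by blast
  qed
  moreover have "{} \<in> set Zs"
  proof -
    \<comment> \<open>Positivity of \<open>D\<close> puts the empty coalition at position 0, and
      shrinking leaves it empty.\<close>
    have "Ys ! 0 = {}" "0 < j" using \<open>0 < D\<close> by (auto simp: Ys_def j_def nth_append)
    then have "Zs ! 0 = {}" using Zs(2)[of 0] by simp
    then show ?thesis using nth_mem[of 0 Zs] lenZ \<open>0 < j\<close> by simp
  qed
  moreover have "P \<in> set Xs" using \<open>0 < D\<close> by (simp add: Xs_def)
  ultimately have cert: "potent_certificate P W j Xs Zs"
    using Zs(1) XsW XsP
    by (auto simp: potent_certificate_def certificate_of_nonweightedness_def winning_def)
  \<comment> \<open>The factor \<open>n + 1\<close> counts \<open>D\<close> and at most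
    \<open>n\<close> multiplicities, each at most \<open>sqrt (real n ^ n)\<close>.\<close>
  have "real j = real D + (\<Sum>v\<in>B1. real (m v))" by (simp add: j_def)
  also have "\<dots> \<le> sqrt (real n ^ n) + (\<Sum>v\<in>B1. sqrt (real n ^ n))"
    using D m by (intro add_mono sum_mono real_le_rsqrt) (auto simp: B1_def)
  also have "\<dots> \<le> sqrt (real n ^ n) + real n * sqrt (real n ^ n)"
    using card_mono[of B B1] \<open>finite B\<close> cardB by (auto simp: B1_def intro!: mult_right_mono)
  finally have "real j \<le> (real n + 1) * sqrt (real n ^ n)" by (simp add: algebra_simps)
  then show ?thesis using cert unfolding P_def by blast
qed

section \<open>A game with long potent certificates\<close>

text \<open>Double counting. It shows that the total weight of a sequence depends only on how often
  each player occurs, so both sides of a trading transform weigh the same.\<close>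

lemma sum_sum_nth_eq:
  fixes w :: "'a \<Rightarrow> nat"
  assumes "finite P" "length Xs = j" "\<forall>X\<in>set Xs. X \<subseteq> P"
  shows "(\<Sum>k<j. \<Sum>i\<in>Xs ! k. w i) = (\<Sum>i\<in>P. w i * card {k. k < j \<and> i \<in> Xs ! k})"
proof -
  have "(\<Sum>k<j. \<Sum>i\<in>Xs ! k. w i) = (\<Sum>k<j. \<Sum>i\<in>P. if i \<in> Xs ! k then w i else 0)"
  proof (rule sum.cong)
    fix k assume "k \<in> {..<j}"
    then have "P \<inter> Xs ! k = Xs ! k" using assms(2,3) nth_mem[of k Xs] by auto
    then show "(\<Sum>i\<in>Xs ! k. w i) = (\<Sum>i\<in>P. if i \<in> Xs ! k then w i else 0)"
      using sum.inter_restrict[OF assms(1), of w "Xs ! k"] by simp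
  qed simp
  also have "\<dots> = (\<Sum>i\<in>P. \<Sum>k<j. if i \<in> Xs ! k then w i else 0)"
    by (rule sum.swap)
  also have "\<dots> = (\<Sum>i\<in>P. w i * card {k. k < j \<and> i \<in> Xs ! k})"
  proof (rule sum.cong)
    fix i
    have "(\<Sum>k<j. if i \<in> Xs ! k then w i else 0) = (\<Sum>k\<in>{k \<in> {..<j}. i \<in> Xs ! k}. w i)"
      by (rule sum.inter_filter[symmetric]) simp
    then show "(\<Sum>k<j. if i \<in> Xs ! k then w i else 0) = w i * card {k. k < j \<and> i \<in> Xs ! k}"
      by simp
  qed simp
  finally show ?thesis .
qed

text \<open>The winning side weighs at least \<open>sum w P + (j - 1) * q\<close>, as it contains
  \<open>P\<close>; the losing side at most \<open>(j - 1) * (q + 1)\<close>, as it contains the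
  empty coalition. Both weigh the same, so \<open>sum w P\<close> is at most
  \<open>j - 1\<close>.\<close>

lemma potent_certificate_length_gt_weight:
  fixes w :: "'a \<Rightarrow> nat"
  assumes cert: "potent_certificate P W j Xs Ys" and P: "finite P"
    and win: "\<And>X. winning P W X \<Longrightarrow> q \<le> sum w X"
    and lose: "\<And>X. losing P W X \<Longrightarrow> sum w X \<le> Suc q"
  shows "sum w P < j"
proof -
  have len: "length Xs = j" "length Ys = j"
    and sub: "\<forall>X\<in>set Xs. X \<subseteq> P" "\<forall>Y\<in>set Ys. Y \<subseteq> P"
    and eq: "\<And>i. i \<in> P \<Longrightarrow> card {k. k < j \<and> i \<in> Xs ! k} = card {k. k < j \<and> i \<in> Ys ! k}"
    and wl: "\<forall>X\<in>set Xs. winning P W X" "\<forall>Y\<in>set Ys. losing P W Y"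
    and mem: "P \<in> set Xs" "{} \<in> set Ys"
    using cert by (auto simp: potent_certificate_def certificate_of_nonweightedness_def trading_transform_def)
  obtain a where a: "a < j" "Xs ! a = P" using mem(1) len(1) by (auto simp: in_set_conv_nth)
  obtain b where b: "b < j" "Ys ! b = {}" using mem(2) len(2) by (auto simp: in_set_conv_nth)
  have "sum w P + (j - 1) * q = sum w P + (\<Sum>k\<in>{..<j} - {a}. q)" using a(1) by simp
  also have "\<dots> \<le> sum w (Xs ! a) + (\<Sum>k\<in>{..<j} - {a}. sum w (Xs ! k))"
    using a(2) len wl(1) by (intro add_mono sum_mono win) auto
  also have "\<dots> = (\<Sum>k<j. sum w (Xs ! k))" using a(1) by (intro sum.remove[symmetric]) auto
  also have "\<dots> = (\<Sum>k<j. sum w (Ys ! k))"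
    using eq by (simp add: sum_sum_nth_eq[OF P len(1) sub(1)] sum_sum_nth_eq[OF P len(2) sub(2)])
  also have "\<dots> = sum w (Ys ! b) + (\<Sum>k\<in>{..<j} - {b}. sum w (Ys ! k))"
    using b(1) by (intro sum.remove) auto
  also have "\<dots> \<le> 0 + (\<Sum>k\<in>{..<j} - {b}. Suc q)"
    using b(2) len wl(2) by (intro add_mono sum_mono lose) auto
  also have "\<dots> = (j - 1) * q + (j - 1)" using b(1) by simp
  finally show ?thesis using a(1) by simp
qed

section \<open>The game and its lack of rough weights\<close>

definition wt :: "nat \<Rightarrow> nat" where
  "wt i = (if i = 4 \<or> i = 5 then 3 else 2)"

text \<open>The game with weights \<open>wt\<close> and quota between 5 and 6, except that the coalitions
  \<open>light_wins\<close> of weight 5 win and the coalitions \<open>heavy_losses\<close> of weight 6 lose. As every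
  weight is at least 2, these exceptions do not destroy monotonicity.\<close>

definition light_wins :: "nat set set" where
  "light_wins = {{3, 5}, {3, 4}, {2, 5}, {1, 4}}"

definition heavy_losses :: "nat \<Rightarrow> nat set set" where
  "heavy_losses n = insert {4, 5} ((\<lambda>i. {1, 2, i}) ` ({1..n} - {1, 2, 4, 5}))"

definition near_weighted_wins :: "nat \<Rightarrow> nat set set" where
  "near_weighted_wins n =
     {X. X \<subseteq> {1..n} \<and> (6 \<le> sum wt X \<and> X \<notin> heavy_losses n \<or> X \<in> light_wins)}"

lemma sum_wt_light_wins: "X \<in> light_wins \<Longrightarrow> sum wt X = 5"
  by (auto simp: light_wins_def wt_def)

lemma sum_wt_heavy_losses: "X \<in> heavy_losses n \<Longrightarrow> sum wt X = 6"
  by (auto simp: heavy_losses_def wt_def)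

lemma sum_wt_all: "5 \<le> n \<Longrightarrow> sum wt {1..n} = 2 * n + 2"
proof (induction n rule: dec_induct)
  case base
  have "{1..5 :: nat} = {1, 2, 3, 4, 5}" by auto
  then show ?case by (simp add: wt_def)
next
  case (step n)
  then show ?case by (simp add: wt_def)
qed

lemma near_weighted_simple_game:
  assumes "5 \<le> n"
  shows "simple_game {1..n} (near_weighted_wins n)"
proof -
  have "{1..n} \<notin> heavy_losses n"
    using sum_wt_heavy_losses[of "{1..n}" n] sum_wt_all[OF assms] assms by auto
  then have all: "{1..n} \<in> near_weighted_wins n"
    using sum_wt_all[OF assms] assms by (simp add: near_weighted_wins_def)
  have none: "{} \<notin> near_weighted_wins n"
    using sum_wt_light_wins[of "{}"] by (auto simp: near_weighted_wins_def)
  have "Y \<in> near_weighted_wins n" if X: "X \<in> near_weighted_wins n" and XY: "X \<subseteq> Y" "Y \<subseteq> {1..n}" for X Y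
  proof (cases "X = Y")
    case False
    then obtain y where y: "y \<in> Y" "y \<notin> X" using XY(1) by auto
    have fin: "finite Y" using XY(2) by (rule finite_subset) simp
    \<comment> \<open>A proper superset of a winning coalition weighs at least 5 + 2 = 7, beyond the
      weight 6 of the heavy losses.\<close>
    have "5 \<le> sum wt X" using X sum_wt_light_wins[of X] by (auto simp: near_weighted_wins_def)
    then have "7 \<le> wt y + sum wt X" by (simp add: wt_def)
    also have "\<dots> = sum wt (insert y X)" using y XY(1) fin finite_subset by (subst sum.insert) auto
    also have "\<dots> \<le> sum wt Y" using y XY(1) fin by (intro sum_mono2) auto
    finally show ?thesis
      using sum_wt_heavy_losses[of Y n] XY(2) by (auto simp: near_weighted_wins_def)
  qed (use X in simp)
  moreover have "near_weighted_wins n \<subseteq> Pow {1..n}" by (auto simp: near_weighted_wins_def)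
  moreover have "near_weighted_wins n \<noteq> Pow {1..n}" using none by auto
  ultimately show ?thesis unfolding simple_game_def using all by blast
qed

text \<open>Rough weights would have to satisfy one linear inequality for each exceptional
  coalition; together with nonnegativity these force all weights and the quota to be 0.\<close>

lemma near_weighted_not_roughly_weighted:
  assumes n: "5 \<le> n"
  shows "\<not> roughly_weighted {1..n} (near_weighted_wins n)"
proof
  assume "roughly_weighted {1..n} (near_weighted_wins n)"
  then obtain u :: "nat \<Rightarrow> real" and q :: real where u: "\<forall>i\<in>{1..n}. 0 \<le> u i"
    and nz: "(\<exists>i\<in>{1..n}. u i \<noteq> 0) \<or> q \<noteq> 0"
    and uq: "\<forall>X. X \<subseteq> {1..n} \<longrightarrow> (sum u X < q \<longrightarrow> losing {1..n} (near_weighted_wins n) X) \<and>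
      (sum u X > q \<longrightarrow> winning {1..n} (near_weighted_wins n) X)"
    unfolding roughly_weighted_def by blast
  have nonneg: "0 \<le> u i" if "i \<in> {1..n}" for i using u that by blast
  have win: "q \<le> sum u X" if "X \<in> light_wins" "X \<subseteq> {1..n}" for X
  proof -
    have "X \<in> near_weighted_wins n" using that by (simp add: near_weighted_wins_def)
    then have "\<not> losing {1..n} (near_weighted_wins n) X" by (simp add: losing_def)
    then show ?thesis using uq that(2) not_less by blast
  qed
  \<comment> \<open>The empty coalition is included because it yields
    \<open>0 \<le> q\<close>.\<close>
  have lose: "sum u X \<le> q" if "X \<in> heavy_losses n \<or> X = {}" "X \<subseteq> {1..n}" for X
  proof -
    have "X \<notin> light_wins"
      using that(1) sum_wt_light_wins[of X] sum_wt_heavy_losses[of X n] by auto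
    then have "X \<notin> near_weighted_wins n" using that(1) by (auto simp: near_weighted_wins_def)
    then have "\<not> winning {1..n} (near_weighted_wins n) X" by (simp add: winning_def)
    then show ?thesis using uq that(2) not_less by blast
  qed
  have "0 \<le> q" using lose[of "{}"] by simp
  have w1: "q \<le> u 3 + u 5" and w2: "q \<le> u 3 + u 4" and w3: "q \<le> u 2 + u 5" and w4: "q \<le> u 1 + u 4"
    using win[of "{3, 5}"] win[of "{3, 4}"] win[of "{2, 5}"] win[of "{1, 4}"] n
    by (simp_all add: light_wins_def)
  have l1: "u 4 + u 5 \<le> q" using lose[of "{4, 5}"] n by (simp add: heavy_losses_def)
  have l2: "u 1 + u 2 + u i \<le> q" if "i \<in> {1..n} - {1, 2, 4, 5}" for i
    using lose[of "{1, 2, i}"] n that by (simp add: heavy_losses_def add.assoc)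
  \<comment> \<open>Adding \<open>w3\<close> and \<open>w4\<close> and subtracting \<open>l1\<close>
    gives \<open>q \<le> u 1 + u 2\<close>, which by \<open>l2\<close> leaves no weight for player
    \<open>i\<close>.\<close>
  have zero: "u i = 0" if "i \<in> {1..n} - {1, 2, 4, 5}" for i
    using l2[OF that] w3 w4 l1 nonneg[of i] that by auto
  then have "u 3 = 0" using n by simp
  \<comment> \<open>Now \<open>u 4\<close> and \<open>u 5\<close> are each at least
    \<open>q\<close>, while their sum is at most \<open>q\<close>.\<close>
  then have "u 4 = 0" "u 5 = 0" "q = 0"
    using w1 w2 l1 nonneg[of 4] nonneg[of 5] \<open>0 \<le> q\<close> n by auto
  moreover from this have "u 1 = 0" "u 2 = 0"
    using l2[of 3] nonneg[of 1] nonneg[of 2] \<open>u 3 = 0\<close> n by auto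
  ultimately show False using nz zero by blast
qed

lemma near_weighted_g_game_ge:
  assumes "5 \<le> n"
  shows "enat (2 * n + 3) \<le> g_game {1..n} (near_weighted_wins n)"
proof -
  have "2 * n + 3 \<le> j" if "potent_certificate {1..n} (near_weighted_wins n) j Xs Ys" for j Xs Ys
  proof -
    have "sum wt {1..n} < j"
    \<comment> \<open>The bound is applied with quota 5: light wins weigh exactly 5, heavy losses
      exactly 6.\<close>
    proof (rule potent_certificate_length_gt_weight[OF that])
      fix X assume "winning {1..n} (near_weighted_wins n) X"
      then show "5 \<le> sum wt X"
        using sum_wt_light_wins[of X] by (auto simp: winning_def near_weighted_wins_def)
    next
      fix X assume "losing {1..n} (near_weighted_wins n) X"
      then show "sum wt X \<le> Suc 5"
        using sum_wt_heavy_losses[of X n] by (auto simp: losing_def near_weighted_wins_def)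
    qed simp
    then show ?thesis using sum_wt_all[OF assms] by simp
  qed
  then show ?thesis
    unfolding g_game_def using near_weighted_not_roughly_weighted[OF assms]
    by (auto intro!: Inf_greatest)
qed

section \<open>Bounds on g\<close>

lemma sqrt_power_self_eq_powr:
  assumes "0 < n"
  shows "sqrt (real n ^ n) = 2 powr (1 / 2 * real n * log 2 (real n))"
proof -
  have "2 powr (1 / 2 * real n * log 2 (real n)) = (2 powr log 2 (real n)) powr (real n * (1 / 2))"
    by (simp add: powr_powr mult_ac)
  also have "\<dots> = (real n powr real n) powr (1 / 2)"
    using assms by (simp add: powr_powr)
  also have "\<dots> = sqrt (real n ^ n)"
    using assms by (simp add: powr_half_sqrt powr_realpow)
  finally show ?thesis ..
qed

theorem theorem12:
  fixes n :: nat
  assumes "n \<ge> 5"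
  shows "enat (2 * n + 3) \<le> g n \<and>
         ereal_of_enat (g n) \<le> ereal ((real n + 1) * 2 powr (1 / 2 * real n * log 2 (real n)))"
proof -
  define G where "G = {g_game {1..n} W |W. simple_game {1..n} W \<and> \<not> roughly_weighted {1..n} W}"
  have "G \<subseteq> g_game {1..n} ` Pow (Pow {1..n})" by (auto simp: G_def simple_game_def)
  then have fin: "finite G" by (rule finite_subset) simp
  \<comment> \<open>This game gives the lower bound and also shows that \<open>G\<close> is
    nonempty, so that \<open>Max G\<close> is attained.\<close>
  have mem: "g_game {1..n} (near_weighted_wins n) \<in> G"
    using near_weighted_simple_game[OF assms(1)] near_weighted_not_roughly_weighted[OF assms(1)]
    by (auto simp: G_def)
  have g: "g n = Max G" by (simp add: g_def G_def)
  have "enat (2 * n + 3) \<le> g n"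
    using near_weighted_g_game_ge[OF assms(1)] Max_ge[OF fin mem] g by simp
  moreover have "ereal_of_enat (g n) \<le> ereal ((real n + 1) * sqrt (real n ^ n))"
  proof -
    have "g n \<in> G" using Max_in[OF fin] mem g by auto
    then obtain W where W: "simple_game {1..n} W" "\<not> roughly_weighted {1..n} W" "g n = g_game {1..n} W"
      by (auto simp: G_def)
    obtain j Xs Ys where j: "potent_certificate {1..n} W j Xs Ys"
        "real j \<le> (real n + 1) * sqrt (real n ^ n)"
      using exists_short_potent_certificate[OF W(1,2)] by blast
    have "g n \<le> enat j"
      using W(2,3) j(1) by (auto simp: g_game_def intro!: Inf_lower)
    then have "ereal_of_enat (g n) \<le> ereal_of_enat (enat j)" by (simp only: ereal_of_enat_le_iff)
    also have "\<dots> = ereal (real j)" by simp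
    also have "\<dots> \<le> ereal ((real n + 1) * sqrt (real n ^ n))" using j(2) by simp
    finally show ?thesis .
  qed
  ultimately show ?thesis using sqrt_power_self_eq_powr[of n] assms(1) by simp
qed

end
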